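(* Let $S=\{4,5,7,12,23,229,562\}$. Suppose that for every positive integer $n$ with $n\notin S$, the number $n!+1$ is square-free. Then the only Wilson primes are $5$, $13$, and $563$.
   Context: A positive integer $k$ is square-free if and only if no perfect square other than $1$ divides $k$. A Wilson prime is a prime $p$ such that $p^2$ divides $(p-1)!+1$. *)

theory Defs
  imports Complex_Main "HOL-Computational_Algebra.Primes" "HOL-Computational_Algebra.Squarefree"
begin

definition wilson_prime :: "nat \<Rightarrow> bool" where
  "wilson_prime p \<longleftrightarrow> prime p \<and> p\<^sup>2 dvd fact (p - 1) + 1"

end

theory Submission
  imports Defs
begin

text \<open>
  If \<^term>\<open>p\<close> is a Wilson prime, then \<^term>\<open>p\<^sup>2\<close> is a nontrivial square divisor of
  \<open>(p - 1)! + 1\<close>, so this number is not square-free. Under the hypothesis, \<open>p - 1\<close> must therefore be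
  one of the seven exceptions \<open>4, 5, 7, 12, 23, 229, 562\<close>. Adding \<open>1\<close> gives
  \<open>5, 6, 8, 13, 24, 230, 563\<close>, where the even numbers are ruled out. That the remaining three are
  indeed Wilson primes is a finite computation. For \<open>563\<close> it is done with integers reduced modulo
  \<open>563\<^sup>2\<close> after every multiplication, so that the numbers stay below \<open>563\<^sup>3\<close>, whereas \<open>562!\<close> itself
  has more than a thousand digits.
\<close>

lemma wilson_prime_imp_not_squarefree:
  assumes "wilson_prime p"
  shows "\<not> squarefree (fact (p - 1) + 1 :: nat)"
  using assms by (auto simp: wilson_prime_def squarefree_def dest: prime_gt_1_nat)

text \<open>
  Residues commute with multiplication, so reducing after each factor gives the residue of the
  factorial. The outer reduction on the right matters only for \<open>n = 0\<close>, where the fold returns its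
  unreduced start value.
\<close>

lemma fact_mod_eq_foldl:
  fixes m :: int
  shows "fact n mod m = foldl (\<lambda>r k. r * k mod m) 1 [1..int n] mod m"
proof (induction n)
  case (Suc n)
  let ?f = "\<lambda>r k. r * k mod m"
  have "fact (Suc n) mod m = (fact n mod m) * int (Suc n) mod m"
    by (simp only: mod_mult_left_eq) (simp add: mult.commute)
  also have "\<dots> = foldl ?f 1 [1..int n] * int (Suc n) mod m"
    by (simp only: Suc.IH mod_mult_left_eq)
  also have "[1..int (Suc n)] = [1..int n] @ [int (Suc n)]"
    by (simp add: upto_rec2)
  then have "foldl ?f 1 [1..int n] * int (Suc n) mod m = foldl ?f 1 [1..int (Suc n)] mod m"
    by (simp only: foldl_append foldl.simps mod_mod_trivial)
  finally show ?case .
qed simp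

text \<open>
  Everything is moved to integers because their numerals are binary in evaluation, whereas
  natural numbers are evaluated in unary.
\<close>

lemma wilson_primeI_foldl:
  assumes "prime (int p)"
    and "foldl (\<lambda>r k. r * k mod (int p)\<^sup>2) 1 [1..int p - 1] = (int p)\<^sup>2 - 1"
  shows "wilson_prime p"
proof -
  have p: "prime p"
    using assms(1) by simp
  then have "int (p - 1) = int p - 1"
    using prime_gt_1_nat[of p] by simp
  then have "fact (p - 1) mod (int p)\<^sup>2 = ((int p)\<^sup>2 - 1) mod (int p)\<^sup>2"
    using fact_mod_eq_foldl[of "p - 1" "(int p)\<^sup>2"] assms(2) by simp
  then have "(int p)\<^sup>2 dvd fact (p - 1) - ((int p)\<^sup>2 - 1)"
    by (simp only: mod_eq_dvd_iff)
  then have "(int p)\<^sup>2 dvd (fact (p - 1) - ((int p)\<^sup>2 - 1)) + (int p)\<^sup>2"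
    by (rule dvd_add) simp
  then have "int (p\<^sup>2) dvd int (fact (p - 1) + 1)"
    by (simp add: add.commute)
  then show ?thesis
    using p by (simp only: of_nat_dvd_iff wilson_prime_def)
qed

lemma wilson_prime_5: "wilson_prime 5"
  by (simp add: wilson_prime_def fact_numeral)

lemma wilson_prime_13: "wilson_prime 13"
  by (simp add: wilson_prime_def fact_numeral)

lemma wilson_prime_563: "wilson_prime 563"
proof (rule wilson_primeI_foldl)
  have "prime (563 :: int)"
    by code_simp
  then show "prime (int 563)"
    by (simp only: of_nat_numeral)
  have "foldl (\<lambda>r k. r * k mod 563\<^sup>2) 1 [1..563 - 1] = (563\<^sup>2 - 1 :: int)"
    by code_simp
  then show "foldl (\<lambda>r k. r * k mod (int 563)\<^sup>2) 1 [1..int 563 - 1] = (int 563)\<^sup>2 - 1"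
    by (simp only: of_nat_numeral)
qed

theorem corollary4p2:
  fixes S :: "nat set"
  assumes S: "S = {4, 5, 7, 12, 23, 229, 562}"
    and sqfree: "\<And>n :: nat. n > 0 \<Longrightarrow> n \<notin> S \<Longrightarrow> squarefree (fact n + 1 :: nat)"
  shows "{p. wilson_prime p} = {5, 13, 563}"
proof
  show "{p. wilson_prime p} \<subseteq> {5, 13, 563}"
  proof
    fix p assume "p \<in> {p. wilson_prime p}"
    then have w: "wilson_prime p" by simp
    then have pr: "prime p" by (simp add: wilson_prime_def)
    then have gt: "p > 1" by (rule prime_gt_1_nat)
    have "p - 1 \<in> S"
      using sqfree[of "p - 1"] wilson_prime_imp_not_squarefree[OF w] gt by auto
    then have "p \<in> {5, 6, 8, 13, 24, 230, 563}"
      using gt unfolding S by auto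
    moreover have "p \<notin> {6, 8, 24, 230}"
    proof
      assume "p \<in> {6, 8, 24, 230}"
      then have "even p" "p \<noteq> 2" by auto
      then show False using pr primes_dvd_imp_eq two_is_prime_nat by blast
    qed
    ultimately show "p \<in> {5, 13, 563}"
      by blast
  qed
  show "{5, 13, 563} \<subseteq> {p. wilson_prime p}"
    using wilson_prime_5 wilson_prime_13 wilson_prime_563 by simp
qed

end
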